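(* For every instance of the inventory routing problem described in the context, the linear program (flow-relaxation), which is based on $|M|$ flows (one per commodity), is a relaxation of the problem (multi-attribute-IRP): for every feasible solution of (multi-attribute-IRP) there is a feasible solution of (flow-relaxation) whose cost is at most the cost of that solution. In particular, the optimal value of (flow-relaxation) is a lower bound on the cost of an optimal solution of (multi-attribute-IRP).
   Context: **Notation.** $[a]=\{1,\dots,a\}$, $(x)^+=\max(x,0)$, $\mathbb{Z}^+$ is the set of non-negative integers. **Instance.** $M$, $D$, $C$ are finite sets (commodities, depots, customers), $D\cap C=\emptyset$; $T$ is the horizon in days. Data, for $m\in M$, $d\in D$, $c\in C$, $v\in D\cup C$, $t\in[T]$: initial inventories $I^0_{mv}\in\mathbb{Z}^+$; releases $b^+_{mdt}\in\mathbb{Z}^+$; demands $b^-_{mct}\in\mathbb{Z}^+$; free inventory capacities $\kappa_{mvt}\ge 0$; unit excess inventory costs $c^{\mathrm{exc}}_{mv}\ge 0$; unit shortage costs $c^{\mathrm{short}}_{mc}\ge 0$; commodity lengths $\ell_m>0$; vehicle length $L>0$; a cost per vehicle $c^{\mathrm{veh}}\ge0$, per stop $c^{\mathrm{stop}}\ge0$ and per kilometer $c^{\mathrm{km}}\ge 0$; a maximum number of stops $S_{\max}\ge 1$; a limit $\tau_{\max}>0$ of driving hours per day. The locations graph is the directed graph with vertex set $D\cup C$ and an arc $(u,v)$ for all $u\in D\cup C$, $v\in C$, $v\ne u$. Each arc $a$ has a distance $\Delta_a\ge0$ and a duration $\tau_a\ge 0$. Distances satisfy the triangle inequality $\Delta_{(u,w)}\le\Delta_{(u,v)}+\Delta_{(v,w)}$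 whenever these three arcs exist. Let $M_d$ be the set of commodities $m$ with $I^0_{md}>0$ or $b^+_{mdt}>0$ for some $t$, and $M_c$ the set of commodities $m$ with $I^0_{mc}>0$ or $b^-_{mct}>0$ for some $t$. Put $D_m=\{d\in D: m\in M_d\}$ and $C_m=\{c\in C: m\in M_c\}$. If $m\notin M_c$, then $\kappa_{mct}=0$ for all $t$ and $c^{\mathrm{exc}}_{mc}=+\infty$ (with $\infty\cdot 0=0$), so that delivering a commodity to a customer that does not use it has infinite cost; all other costs are finite. **Routes.** An admissible path is $P=(v_0,v_1,\dots,v_k)$ with $v_0\in D$, $v_1,\dots,v_k\in C$ pairwise distinct, $1\le k\le S_{\max}$; we write $|P|=k+1$ and $A(P)$ for its set of arcs. (Paths do not return to the depot.) A route is a tuple $r=(t^r,P^r,\mathbf{q}^r)$ with departure day $t^r\in[T]$, admissible path $P^r=(v^r_0,\dots,v^r_k)$ and delivered quantities $q^r_{ms}\in\mathbb{Z}^+$ for $m\in M$, $s\in[|P^r|-1]$, such that $$\sum_{m\in M}\ell_m\sum_{s\in[|P^r|-1]} q^r_{ms}\le L,$$ and such that the arrival days $t^r_s=t^r+\lfloor \tau^r_s/\tau_{\max}\rfloor$, where $\tau^r_s=\sum_{i=1}^{s}\tau_{(v^r_{i-1},v^r_i)}$, satisfy $t^r_s\le T$ for all $s\in[|P^r|-1]$. Let $\mathcal{R}$ be the set of all routes. **(multi-attribute-IRP).** The variables are non-negative integers $x_r$ ($r\in\mathcal{R}$; number of vehicles following $r$), $z^-_{mdt}$, $z^+_{mct}$,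 $I_{mvt}$ ($t\in\{0,\dots,T\}$ for $I$). Minimize $$\sum_{r\in\mathcal{R}}x_r\Big(c^{\mathrm{veh}}+c^{\mathrm{stop}}(|P^r|-1)+c^{\mathrm{km}}\sum_{a\in A(P^r)}\Delta_a\Big)+\sum_{d,t,m}c^{\mathrm{exc}}_{md}(I_{mdt}-\kappa_{mdt})^+ +\sum_{c,t,m}\Big(c^{\mathrm{exc}}_{mc}(I_{mct}-\kappa_{mct})^+ + c^{\mathrm{short}}_{mc}(b^-_{mct}-I_{mc(t-1)})^+\Big)$$ (sums over $t\in[T]$), subject to, for all $m\in M$, $d\in D$, $c\in C$, $t\in[T]$: - $z^-_{mdt}=\sum_{r:\,v^r_0=d,\,t^r=t}\ \sum_{s\in[|P^r|-1]}x_rq^r_{ms}$; - $z^+_{mct}=\sum_{r}\ \sum_{s\in[|P^r|-1]:\,t^r_s=t,\,v^r_s=c}x_rq^r_{ms}$; - $I_{mdt}=I_{md(t-1)}+b^+_{mdt}-z^-_{mdt}$ and $I_{md0}=I^0_{md}$; - $I_{mct}=(I_{mc(t-1)}-b^-_{mct})^++z^+_{mct}$ and $I_{mc0}=I^0_{mc}$. **Commodity graph.** For each $m\in M$, $\mathcal{D}^m=(\mathcal{V}^m,\mathcal{A}^m)$ is the directed multigraph (parallel arcs allowed) with the following vertices: $(t,v,\mathrm{morning})$ for $t\in[T+1]$ and $(t,v,\mathrm{evening})$ for $t\in[T]$, for each $v\in D_m\cup C_m$; and the artificial vertices source, sink, initial inventory, final inventory, release, shortage, demand. Each arc has a lower bound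 (0 unless stated), an upper bound ($\infty$ unless stated) and a unit cost (0 unless stated). The arcs, for $d\in D_m$, $c\in C_m$, $v\in D_m\cup C_m$, $t\in[T]$, are: - initial inventory $\to(1,v,\mathrm{morning})$, lower and upper bound $I^0_{mv}$; - $(T+1,v,\mathrm{morning})\to$ final inventory; - release $\to(t,d,\mathrm{morning})$, lower and upper bound $b^+_{mdt}$; - $(t,c,\mathrm{morning})\to$ demand, lower and upper bound $b^-_{mct}$; - shortage $\to(t,c,\mathrm{morning})$, cost $c^{\mathrm{short}}_{mc}$; - $(t,v,\mathrm{morning})\to(t,v,\mathrm{evening})$; - two parallel arcs $(t,v,\mathrm{evening})\to(t+1,v,\mathrm{morning})$: one with upper bound $\kappa_{mvt}$ and cost 0, the other with upper bound $\infty$ and cost $c^{\mathrm{exc}}_{mv}$; - direct transport arcs $(t,d,\mathrm{morning})\to(t+\lfloor\tau_{(d,c)}/\tau_{\max}\rfloor,c,\mathrm{evening})$, whenever the arrival day is at most $T$, with cost $c^{\mathrm{tr}}_{mdc}$; - delayed transport arcs $(t,d,\mathrm{morning})\to(\tilde t,c,\mathrm{evening})$, one for each day $\tilde t\le T$ that is the arrival day at $c$, when departing on day $t$, of some admissible path that starts at $d$, visits at least one other customer (any customers of $C$) and then ends at $c$, with cost $c^{\mathrm{tr}}_{mdc}$ (the arrival day is $t+\lfloor\tau/\tau_{\max}\rfloor$ with $\tau$ the total duration of the path); - source $\to$ release, source $\to$ initial inventory, source $\to$ shortage, demand $\to$ sink, final inventory $\to$ sink, sink $\to$ source. Here $$c^{\mathrm{tr}}_{mdc}=\frac{\ell_m}{L}\big(c^{\mathrm{veh}}+c^{\mathrm{stop}}+c^{\mathrm{km}}\Delta_{(d,c)}\big).$$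 **(flow-relaxation).** Minimize $\sum_{m\in M}\sum_{a\in\mathcal{A}^m}c_{ma}y_{ma}$, where $c_{ma}$ is the unit cost of arc $a$ in $\mathcal{D}^m$, over real vectors $y_m=(y_{ma})_{a\in\mathcal{A}^m}$, $m\in M$, such that each $y_m$ is a circulation on $\mathcal{D}^m$ (at every vertex, total outgoing flow equals total incoming flow) respecting the lower and upper bounds of all arcs. *)

theory Defs
  imports "HOL-Library.Extended_Real" "Graph_Theory.Digraph"
begin

text \<open>
  Depots and customers are disjoint subsets of one type of locations, and days are natural
  numbers, day 1 being the first. Data are total functions; only their values at the commodities,
  locations, arcs and days of the instance are ever constrained or used. Unit excess costs are
  extended reals, where \<open>\<infinity> * 0 = 0\<close>.
\<close>

record ('m, 'v) irp =
  commodities :: "'m set"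
  depots :: "'v set"
  customers :: "'v set"
  horizon :: nat
  init_inv :: "'m \<Rightarrow> 'v \<Rightarrow> nat"
  release :: "'m \<Rightarrow> 'v \<Rightarrow> nat \<Rightarrow> nat"
  demand :: "'m \<Rightarrow> 'v \<Rightarrow> nat \<Rightarrow> nat"
  free_cap :: "'m \<Rightarrow> 'v \<Rightarrow> nat \<Rightarrow> real"
  exc_cost :: "'m \<Rightarrow> 'v \<Rightarrow> ereal"
  short_cost :: "'m \<Rightarrow> 'v \<Rightarrow> real"
  com_length :: "'m \<Rightarrow> real"
  veh_length :: real
  veh_cost :: real
  stop_cost :: real
  km_cost :: real
  max_stops :: nat
  max_hours :: real
  distance :: "'v \<times> 'v \<Rightarrow> real"
  duration :: "'v \<times> 'v \<Rightarrow> real"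

definition loc_arcs :: "('m, 'v) irp \<Rightarrow> ('v \<times> 'v) set" where
  "loc_arcs N = {(u, v). u \<in> depots N \<union> customers N \<and> v \<in> customers N \<and> v \<noteq> u}"

definition depot_coms :: "('m, 'v) irp \<Rightarrow> 'v \<Rightarrow> 'm set" where
  "depot_coms N d = {m \<in> commodities N.
     init_inv N m d > 0 \<or> (\<exists>t\<in>{1..horizon N}. release N m d t > 0)}"

definition customer_coms :: "('m, 'v) irp \<Rightarrow> 'v \<Rightarrow> 'm set" where
  "customer_coms N c = {m \<in> commodities N.
     init_inv N m c > 0 \<or> (\<exists>t\<in>{1..horizon N}. demand N m c t > 0)}"

definition com_depots :: "('m, 'v) irp \<Rightarrow> 'm \<Rightarrow> 'v set" where
  "com_depots N m = {d \<in> depots N. m \<in> depot_coms N d}"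

definition com_customers :: "('m, 'v) irp \<Rightarrow> 'm \<Rightarrow> 'v set" where
  "com_customers N m = {c \<in> customers N. m \<in> customer_coms N c}"

definition irp_instance :: "('m, 'v) irp \<Rightarrow> bool" where
  "irp_instance N \<longleftrightarrow>
     finite (commodities N) \<and> finite (depots N) \<and> finite (customers N) \<and>
     depots N \<inter> customers N = {} \<and>
     (\<forall>m\<in>commodities N. \<forall>v\<in>depots N \<union> customers N. \<forall>t\<in>{1..horizon N}. 0 \<le> free_cap N m v t) \<and>
     (\<forall>m\<in>commodities N. \<forall>d\<in>depots N. 0 \<le> exc_cost N m d \<and> exc_cost N m d < \<infinity>) \<and>
     (\<forall>c\<in>customers N. \<forall>m\<in>customer_coms N c. 0 \<le> exc_cost N m c \<and> exc_cost N m c < \<infinity>) \<and>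
     (\<forall>c\<in>customers N. \<forall>m\<in>commodities N - customer_coms N c.
        exc_cost N m c = \<infinity> \<and> (\<forall>t\<in>{1..horizon N}. free_cap N m c t = 0)) \<and>
     (\<forall>m\<in>commodities N. \<forall>c\<in>customers N. 0 \<le> short_cost N m c) \<and>
     (\<forall>m\<in>commodities N. 0 < com_length N m) \<and>
     0 < veh_length N \<and> 0 \<le> veh_cost N \<and> 0 \<le> stop_cost N \<and> 0 \<le> km_cost N \<and>
     1 \<le> max_stops N \<and> 0 < max_hours N \<and>
     (\<forall>a\<in>loc_arcs N. 0 \<le> distance N a \<and> 0 \<le> duration N a) \<and>
     (\<forall>u v w. (u, v) \<in> loc_arcs N \<longrightarrow> (v, w) \<in> loc_arcs N \<longrightarrow> (u, w) \<in> loc_arcs N \<longrightarrow>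
        distance N (u, w) \<le> distance N (u, v) + distance N (v, w))"

text \<open>
  A path \<open>(v\<^sub>0, \<dots>, v\<^sub>k)\<close> is the list of its vertices, so \<open>P ! s\<close> is its \<open>s\<close>-th vertex, and its stops
  are indexed by \<open>{1..<length P}\<close>.
\<close>

definition admissible_path :: "('m, 'v) irp \<Rightarrow> 'v list \<Rightarrow> bool" where
  "admissible_path N P \<longleftrightarrow>
     2 \<le> length P \<and> length P \<le> max_stops N + 1 \<and>
     hd P \<in> depots N \<and> set (tl P) \<subseteq> customers N \<and> distinct (tl P)"

definition path_arcs :: "'v list \<Rightarrow> ('v \<times> 'v) set" where
  "path_arcs P = {(P ! (s - 1), P ! s) | s. s \<in> {1..<length P}}"

definition travel_time :: "('m, 'v) irp \<Rightarrow> 'v list \<Rightarrow> nat \<Rightarrow> real" where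
  "travel_time N P s = (\<Sum>i = 1..s. duration N (P ! (i - 1), P ! i))"

definition arrival_day :: "('m, 'v) irp \<Rightarrow> nat \<Rightarrow> 'v list \<Rightarrow> nat \<Rightarrow> nat" where
  "arrival_day N t P s = t + nat \<lfloor>travel_time N P s / max_hours N\<rfloor>"

record ('m, 'v) route =
  dep_day :: nat
  rpath :: "'v list"
  qty :: "'m \<Rightarrow> nat \<Rightarrow> nat"

abbreviation stops :: "('m, 'v) route \<Rightarrow> nat set" where
  "stops r \<equiv> {1..<length (rpath r)}"

text \<open>
  Quantities are only meaningful for commodities of the instance and stops of the path. They are
  required to vanish elsewhere, so that a route is determined by its meaningful data; in particular
  there are finitely many routes.
\<close>

definition routes :: "('m, 'v) irp \<Rightarrow> ('m, 'v) route set" where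
  "routes N = {r.
     dep_day r \<in> {1..horizon N} \<and>
     admissible_path N (rpath r) \<and>
     (\<forall>m s. m \<notin> commodities N \<or> s \<notin> stops r \<longrightarrow> qty r m s = 0) \<and>
     (\<Sum>m\<in>commodities N. com_length N m * (\<Sum>s\<in>stops r. real (qty r m s))) \<le> veh_length N \<and>
     (\<forall>s\<in>stops r. arrival_day N (dep_day r) (rpath r) s \<le> horizon N)}"

definition route_cost :: "('m, 'v) irp \<Rightarrow> ('m, 'v) route \<Rightarrow> real" where
  "route_cost N r = veh_cost N + stop_cost N * real (length (rpath r) - 1)
     + km_cost N * (\<Sum>a\<in>path_arcs (rpath r). distance N a)"

record ('m, 'v) irp_sol =
  vehicles :: "('m, 'v) route \<Rightarrow> nat"
  sent :: "'m \<Rightarrow> 'v \<Rightarrow> nat \<Rightarrow> nat"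
  received :: "'m \<Rightarrow> 'v \<Rightarrow> nat \<Rightarrow> nat"
  inv_level :: "'m \<Rightarrow> 'v \<Rightarrow> nat \<Rightarrow> nat"

text \<open>The inventory dynamics are stated over the integers, to avoid truncated subtraction.\<close>

definition irp_feasible :: "('m, 'v) irp \<Rightarrow> ('m, 'v) irp_sol \<Rightarrow> bool" where
  "irp_feasible N S \<longleftrightarrow>
     (\<forall>m\<in>commodities N. \<forall>d\<in>depots N.
        inv_level S m d 0 = init_inv N m d \<and>
        (\<forall>t\<in>{1..horizon N}.
           sent S m d t = (\<Sum>r\<in>{r \<in> routes N. hd (rpath r) = d \<and> dep_day r = t}.
              \<Sum>s\<in>stops r. vehicles S r * qty r m s) \<and>
           int (inv_level S m d t) =
              int (inv_level S m d (t - 1)) + int (release N m d t) - int (sent S m d t))) \<and>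
     (\<forall>m\<in>commodities N. \<forall>c\<in>customers N.
        inv_level S m c 0 = init_inv N m c \<and>
        (\<forall>t\<in>{1..horizon N}.
           received S m c t = (\<Sum>r\<in>routes N.
              \<Sum>s\<in>{s \<in> stops r. arrival_day N (dep_day r) (rpath r) s = t \<and> rpath r ! s = c}.
                vehicles S r * qty r m s) \<and>
           int (inv_level S m c t) =
              max (int (inv_level S m c (t - 1)) - int (demand N m c t)) 0 + int (received S m c t)))"

definition irp_cost :: "('m, 'v) irp \<Rightarrow> ('m, 'v) irp_sol \<Rightarrow> ereal" where
  "irp_cost N S =
     ereal (\<Sum>r\<in>routes N. real (vehicles S r) * route_cost N r)
     + (\<Sum>d\<in>depots N. \<Sum>t = 1..horizon N. \<Sum>m\<in>commodities N.
          exc_cost N m d * ereal (max (real (inv_level S m d t) - free_cap N m d t) 0))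
     + (\<Sum>c\<in>customers N. \<Sum>t = 1..horizon N. \<Sum>m\<in>commodities N.
          exc_cost N m c * ereal (max (real (inv_level S m c t) - free_cap N m c t) 0)
          + ereal (short_cost N m c
              * max (real (demand N m c t) - real (inv_level S m c (t - 1))) 0))"

definition irp_optimal :: "('m, 'v) irp \<Rightarrow> ('m, 'v) irp_sol \<Rightarrow> bool" where
  "irp_optimal N S \<longleftrightarrow>
     irp_feasible N S \<and> (\<forall>S'. irp_feasible N S' \<longrightarrow> irp_cost N S \<le> irp_cost N S')"

definition irp_value :: "('m, 'v) irp \<Rightarrow> ereal" where
  "irp_value N = (INF S \<in> {S. irp_feasible N S}. irp_cost N S)"

datatype 'v cvertex =
    Morning nat 'v | Evening nat 'v
  | Source | Sink | Initial_Inventory | Final_Inventory | Release | Shortage | Demand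

text \<open>
  The arcs are named objects, so that parallel ones stay distinct: \<open>Free_Inv\<close> and \<open>Excess_Inv\<close> are
  the two overnight arcs, and a direct transport arc \<open>Direct t d c\<close> may be parallel to a delayed one
  \<open>Delayed t d t' c\<close>, where \<open>t'\<close> is the arrival day.
\<close>

datatype 'v carc =
    Initial 'v | Final 'v
  | Releasing nat 'v | Demanding nat 'v | Lacking nat 'v
  | Daytime nat 'v | Free_Inv nat 'v | Excess_Inv nat 'v
  | Direct nat 'v 'v | Delayed nat 'v nat 'v
  | Source_Release | Source_Initial | Source_Shortage | Demand_Sink | Final_Sink | Sink_Source

fun carc_tail :: "('m, 'v) irp \<Rightarrow> 'v carc \<Rightarrow> 'v cvertex" where
  "carc_tail N (Initial v) = Initial_Inventory"
| "carc_tail N (Final v) = Morning (horizon N + 1) v"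
| "carc_tail N (Releasing t d) = Release"
| "carc_tail N (Demanding t c) = Morning t c"
| "carc_tail N (Lacking t c) = Shortage"
| "carc_tail N (Daytime t v) = Morning t v"
| "carc_tail N (Free_Inv t v) = Evening t v"
| "carc_tail N (Excess_Inv t v) = Evening t v"
| "carc_tail N (Direct t d c) = Morning t d"
| "carc_tail N (Delayed t d t' c) = Morning t d"
| "carc_tail N Source_Release = Source"
| "carc_tail N Source_Initial = Source"
| "carc_tail N Source_Shortage = Source"
| "carc_tail N Demand_Sink = Demand"
| "carc_tail N Final_Sink = Final_Inventory"
| "carc_tail N Sink_Source = Sink"

fun carc_head :: "('m, 'v) irp \<Rightarrow> 'v carc \<Rightarrow> 'v cvertex" where
  "carc_head N (Initial v) = Morning 1 v"
| "carc_head N (Final v) = Final_Inventory"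
| "carc_head N (Releasing t d) = Morning t d"
| "carc_head N (Demanding t c) = Demand"
| "carc_head N (Lacking t c) = Morning t c"
| "carc_head N (Daytime t v) = Evening t v"
| "carc_head N (Free_Inv t v) = Morning (t + 1) v"
| "carc_head N (Excess_Inv t v) = Morning (t + 1) v"
| "carc_head N (Direct t d c) = Evening (arrival_day N t [d, c] 1) c"
| "carc_head N (Delayed t d t' c) = Evening t' c"
| "carc_head N Source_Release = Release"
| "carc_head N Source_Initial = Initial_Inventory"
| "carc_head N Source_Shortage = Shortage"
| "carc_head N Demand_Sink = Sink"
| "carc_head N Final_Sink = Sink"
| "carc_head N Sink_Source = Source"

definition com_verts :: "('m, 'v) irp \<Rightarrow> 'm \<Rightarrow> 'v cvertex set" where
  "com_verts N m =
     {Morning t v | t v. t \<in> {1..horizon N + 1} \<and> v \<in> com_depots N m \<union> com_customers N m}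
     \<union> {Evening t v | t v. t \<in> {1..horizon N} \<and> v \<in> com_depots N m \<union> com_customers N m}
     \<union> {Source, Sink, Initial_Inventory, Final_Inventory, Release, Shortage, Demand}"

definition com_arcs :: "('m, 'v) irp \<Rightarrow> 'm \<Rightarrow> 'v carc set" where
  "com_arcs N m = (let V = com_depots N m \<union> com_customers N m; days = {1..horizon N} in
     {Initial v | v. v \<in> V}
     \<union> {Final v | v. v \<in> V}
     \<union> {Releasing t d | t d. t \<in> days \<and> d \<in> com_depots N m}
     \<union> {Demanding t c | t c. t \<in> days \<and> c \<in> com_customers N m}
     \<union> {Lacking t c | t c. t \<in> days \<and> c \<in> com_customers N m}
     \<union> {Daytime t v | t v. t \<in> days \<and> v \<in> V}
     \<union> {Free_Inv t v | t v. t \<in> days \<and> v \<in> V}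
     \<union> {Excess_Inv t v | t v. t \<in> days \<and> v \<in> V}
     \<union> {Direct t d c | t d c. t \<in> days \<and> d \<in> com_depots N m \<and> c \<in> com_customers N m \<and>
          arrival_day N t [d, c] 1 \<le> horizon N}
     \<union> {Delayed t d t' c | t d t' c. t \<in> days \<and> d \<in> com_depots N m \<and> c \<in> com_customers N m \<and>
          t' \<le> horizon N \<and>
          (\<exists>P. admissible_path N P \<and> 3 \<le> length P \<and> hd P = d \<and> last P = c \<and>
             t' = arrival_day N t P (length P - 1))}
     \<union> {Source_Release, Source_Initial, Source_Shortage, Demand_Sink, Final_Sink, Sink_Source})"

definition commodity_graph :: "('m, 'v) irp \<Rightarrow> 'm \<Rightarrow> ('v cvertex, 'v carc) pre_digraph" where
  "commodity_graph N m =
     \<lparr>verts = com_verts N m, arcs = com_arcs N m, tail = carc_tail N, head = carc_head N\<rparr>"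

definition transport_cost :: "('m, 'v) irp \<Rightarrow> 'm \<Rightarrow> 'v \<Rightarrow> 'v \<Rightarrow> real" where
  "transport_cost N m d c = com_length N m / veh_length N
     * (veh_cost N + stop_cost N + km_cost N * distance N (d, c))"

fun lower_bound :: "('m, 'v) irp \<Rightarrow> 'm \<Rightarrow> 'v carc \<Rightarrow> real" where
  "lower_bound N m (Initial v) = real (init_inv N m v)"
| "lower_bound N m (Releasing t d) = real (release N m d t)"
| "lower_bound N m (Demanding t c) = real (demand N m c t)"
| "lower_bound N m _ = 0"

fun upper_bound :: "('m, 'v) irp \<Rightarrow> 'm \<Rightarrow> 'v carc \<Rightarrow> ereal" where
  "upper_bound N m (Initial v) = ereal (real (init_inv N m v))"
| "upper_bound N m (Releasing t d) = ereal (real (release N m d t))"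
| "upper_bound N m (Demanding t c) = ereal (real (demand N m c t))"
| "upper_bound N m (Free_Inv t v) = ereal (free_cap N m v t)"
| "upper_bound N m _ = \<infinity>"

fun unit_cost :: "('m, 'v) irp \<Rightarrow> 'm \<Rightarrow> 'v carc \<Rightarrow> ereal" where
  "unit_cost N m (Lacking t c) = ereal (short_cost N m c)"
| "unit_cost N m (Excess_Inv t v) = exc_cost N m v"
| "unit_cost N m (Direct t d c) = ereal (transport_cost N m d c)"
| "unit_cost N m (Delayed t d t' c) = ereal (transport_cost N m d c)"
| "unit_cost N m _ = 0"

definition circulation :: "('a, 'b) pre_digraph \<Rightarrow> ('b \<Rightarrow> real) \<Rightarrow> bool" where
  "circulation G f \<longleftrightarrow> (\<forall>v\<in>verts G. sum f (out_arcs G v) = sum f (in_arcs G v))"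

definition flow_feasible :: "('m, 'v) irp \<Rightarrow> ('m \<Rightarrow> 'v carc \<Rightarrow> real) \<Rightarrow> bool" where
  "flow_feasible N y \<longleftrightarrow> (\<forall>m\<in>commodities N.
     circulation (commodity_graph N m) (y m) \<and>
     (\<forall>a\<in>arcs (commodity_graph N m).
        lower_bound N m a \<le> y m a \<and> ereal (y m a) \<le> upper_bound N m a))"

definition flow_cost :: "('m, 'v) irp \<Rightarrow> ('m \<Rightarrow> 'v carc \<Rightarrow> real) \<Rightarrow> ereal" where
  "flow_cost N y =
     (\<Sum>m\<in>commodities N. \<Sum>a\<in>arcs (commodity_graph N m). unit_cost N m a * ereal (y m a))"

definition flow_value :: "('m, 'v) irp \<Rightarrow> ereal" where
  "flow_value N = (INF y \<in> {y. flow_feasible N y}. flow_cost N y)"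

text \<open>
  The sums over routes and over arcs above range over finite sets, so none of them is zero by
  convention, and the commodity graphs are well-formed.
\<close>

lemma finite_admissible_paths:
  assumes "irp_instance N"
  shows "finite {P. admissible_path N P}"
proof (rule finite_subset)
  show "{P. admissible_path N P}
    \<subseteq> {P. set P \<subseteq> depots N \<union> customers N \<and> length P \<le> max_stops N + 1}"
  proof clarify
    fix P assume "admissible_path N P"
    then show "set P \<subseteq> depots N \<union> customers N \<and> length P \<le> max_stops N + 1"
      by (cases P) (auto simp: admissible_path_def)
  qed
  show "finite {P. set P \<subseteq> depots N \<union> customers N \<and> length P \<le> max_stops N + 1}"
    using assms by (intro finite_lists_length_le) (auto simp: irp_instance_def)
qed

lemma finite_routes:
  assumes "irp_instance N"
  shows "finite (routes N)"
proof -
  define M where "M = commodities N"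
  define B where "B = (\<Sum>m\<in>M. nat \<lfloor>veh_length N / com_length N m\<rfloor>)"
  define Q where "Q = {f. \<forall>p. (p \<in> M \<times> {..max_stops N} \<longrightarrow> f p \<in> {..B}) \<and>
    (p \<notin> M \<times> {..max_stops N} \<longrightarrow> f p = (0::nat))}"
  have M: "finite M" "\<And>m. m \<in> M \<Longrightarrow> 0 < com_length N m"
    using assms by (auto simp: irp_instance_def M_def)
  have "finite Q"
    unfolding Q_def by (rule finite_set_of_finite_funs) (use M in auto)
  have *: "qty r m s \<le> B" if r: "r \<in> routes N" and m: "m \<in> M" and s: "s \<in> stops r" for r m s
  proof -
    have "com_length N m * real (qty r m s) \<le> com_length N m * (\<Sum>s\<in>stops r. real (qty r m s))"
      using M(2)[OF m] s by (intro mult_left_mono member_le_sum) auto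
    also have "\<dots> \<le> (\<Sum>m\<in>M. com_length N m * (\<Sum>s\<in>stops r. real (qty r m s)))"
      using M(1) m by (intro member_le_sum[of m M "\<lambda>m. com_length N m * (\<Sum>s\<in>stops r. real (qty r m s))"])
        (auto intro!: mult_nonneg_nonneg sum_nonneg less_imp_le[OF M(2)])
    also have "\<dots> \<le> veh_length N"
      using r by (simp add: routes_def M_def)
    finally have "real (qty r m s) \<le> veh_length N / com_length N m"
      using M(2)[OF m] by (simp add: field_simps)
    then have "qty r m s \<le> nat \<lfloor>veh_length N / com_length N m\<rfloor>"
      by (simp add: le_nat_floor)
    also have "\<dots> \<le> B"
      unfolding B_def using M m by (intro member_le_sum) auto
    finally show ?thesis .
  qed
  have "routes N \<subseteq> (\<lambda>(t, P, f). \<lparr>dep_day = t, rpath = P, qty = curry f\<rparr>) `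
    ({1..horizon N} \<times> {P. admissible_path N P} \<times> Q)"
  proof
    fix r assume r: "r \<in> routes N"
    have z: "qty r m s = 0" if "m \<notin> M \<or> s \<notin> stops r" for m s
      using r that by (auto simp: routes_def M_def)
    have stops: "stops r \<subseteq> {..max_stops N}"
      using r by (auto simp: routes_def admissible_path_def)
    have "qty r m s \<le> B" for m s
      using *[OF r, of m s] z[of m s] by (cases "m \<in> M \<and> s \<in> stops r") auto
    moreover have "qty r m s = 0" if "m \<notin> M \<or> s \<notin> {..max_stops N}" for m s
      using that stops by (intro z) blast
    ultimately have "(\<lambda>(m, s). qty r m s) \<in> Q"
      by (simp add: Q_def)
    moreover have "dep_day r \<in> {1..horizon N}" "admissible_path N (rpath r)"
      using r by (auto simp: routes_def)
    ultimately show "r \<in> (\<lambda>(t, P, f). \<lparr>dep_day = t, rpath = P, qty = curry f\<rparr>) `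
      ({1..horizon N} \<times> {P. admissible_path N P} \<times> Q)"
      by (intro image_eqI[where x = "(dep_day r, rpath r, \<lambda>(m, s). qty r m s)"])
        (auto simp: curry_def)
  qed
  then show ?thesis
    by (rule finite_subset) (use \<open>finite Q\<close> finite_admissible_paths[OF assms] in auto)
qed

lemma fin_digraph_commodity_graph:
  assumes "irp_instance N"
  shows "fin_digraph (commodity_graph N m)"
proof -
  have fin: "finite (com_depots N m)" "finite (com_customers N m)"
    using assms by (auto simp: irp_instance_def com_depots_def com_customers_def)
  show ?thesis
  proof
    fix a assume "a \<in> arcs (commodity_graph N m)"
    then show "tail (commodity_graph N m) a \<in> verts (commodity_graph N m)"
      by (auto simp: commodity_graph_def com_arcs_def com_verts_def Let_def)
  next
    fix a assume "a \<in> arcs (commodity_graph N m)"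
    then show "head (commodity_graph N m) a \<in> verts (commodity_graph N m)"
      by (auto simp: commodity_graph_def com_arcs_def com_verts_def Let_def arrival_day_def)
  next
    let ?V = "com_depots N m \<union> com_customers N m"
    have "com_verts N m \<subseteq> (\<lambda>(t, v). Morning t v) ` ({1..horizon N + 1} \<times> ?V)
      \<union> (\<lambda>(t, v). Evening t v) ` ({1..horizon N} \<times> ?V)
      \<union> {Source, Sink, Initial_Inventory, Final_Inventory, Release, Shortage, Demand}"
      by (auto simp: com_verts_def)
    then show "finite (verts (commodity_graph N m))"
      unfolding commodity_graph_def by (simp, rule finite_subset) (use fin in auto)
  next
    let ?V = "com_depots N m \<union> com_customers N m"
    let ?X = "{..horizon N} \<times> ?V"
    have "com_arcs N m \<subseteq> Initial ` ?V \<union> Final ` ?V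
      \<union> case_prod Releasing ` ?X \<union> case_prod Demanding ` ?X \<union> case_prod Lacking ` ?X
      \<union> case_prod Daytime ` ?X \<union> case_prod Free_Inv ` ?X \<union> case_prod Excess_Inv ` ?X
      \<union> (\<lambda>(t, d, c). Direct t d c) ` ({..horizon N} \<times> ?V \<times> ?V)
      \<union> (\<lambda>(t, d, t', c). Delayed t d t' c) ` ({..horizon N} \<times> ?V \<times> {..horizon N} \<times> ?V)
      \<union> {Source_Release, Source_Initial, Source_Shortage, Demand_Sink, Final_Sink, Sink_Source}"
      unfolding com_arcs_def Let_def by (intro Un_mono order_refl) (auto simp: image_iff)
    then show "finite (arcs (commodity_graph N m))"
      unfolding commodity_graph_def by (simp, rule finite_subset) (use fin in auto)
  qed
qed

end

theory Submission
  imports Defs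
begin

text \<open>
  A feasible routing solution is turned into one flow per commodity by forgetting which vehicle
  carries what. A delivery at the first stop of a route travels on a direct transport arc, a
  delivery at a later stop on the delayed transport arc of its actual arrival day, and the
  inventories and unmet demands fill the remaining arcs (\<open>induced_flow\<close>). Balance at the morning and
  evening vertices is then the inventory recursion of the solution, and balance at the artificial
  vertices is bookkeeping. If the customer uses the commodity, then the arc of a delivery belongs to
  the commodity graph, for two reasons: a depot that never holds the commodity cannot send it, since
  its inventory would become negative, and cutting a path after a stop leaves an admissible path
  with the same arrival day there (\<open>delivery_arc_in_com_arcs\<close>).

  Excess and shortage costs carry over unchanged. For the transport costs
  (\<open>transport_cost_le_vehicle_cost\<close>), the triangle inequality bounds the distance from the depot to a
  stop by the length of the path, so one unit of \<open>m\<close> pays at most the fraction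
  \<open>\<ell>\<^sub>m / L\<close> of the cost of the route that carries it; the loads of a vehicle have total length at
  most \<open>L\<close>, so these fractions add up to at most one vehicle.

  The commodity graph has no vertex for a customer that does not use the commodity, so the
  construction needs solutions that never deliver there. A solution that does has infinite cost,
  and any feasible flow bounds it; the flow induced by keeping all vehicles at home is one.
\<close>

section \<open>Circulations\<close>

text \<open>Every arc has exactly one tail and one head, so both sides are the total flow of all arcs.\<close>

lemma sum_out_arcs_eq_sum_in_arcs:
  assumes "fin_digraph G"
  shows "(\<Sum>v\<in>verts G. sum f (out_arcs G v)) = (\<Sum>v\<in>verts G. sum f (in_arcs G v))"
proof -
  interpret fin_digraph G by fact
  have "(\<Sum>v\<in>verts G. sum f (out_arcs G v)) = sum f (arcs G)"
    unfolding out_arcs_def by (rule sum.group) auto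
  moreover have "(\<Sum>v\<in>verts G. sum f (in_arcs G v)) = sum f (arcs G)"
    unfolding in_arcs_def by (rule sum.group) auto
  ultimately show ?thesis by simp
qed

text \<open>
  The net outflows of all vertices add up to zero, so balance at all vertices but one forces balance
  at the last one. For the commodity graphs this spares the source, where balance would otherwise
  amount to the conservation of the commodity over the whole horizon.
\<close>

lemma circulationI_except_one:
  fixes f :: "'b \<Rightarrow> real"
  assumes "fin_digraph G" and u: "u \<in> verts G"
    and bal: "\<And>v. v \<in> verts G \<Longrightarrow> v \<noteq> u \<Longrightarrow> sum f (out_arcs G v) = sum f (in_arcs G v)"
  shows "circulation G f"
proof -
  interpret fin_digraph G by fact
  have "(\<Sum>v\<in>verts G - {u}. sum f (out_arcs G v)) = (\<Sum>v\<in>verts G - {u}. sum f (in_arcs G v))"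
    by (rule sum.cong[OF refl], rule bal) auto
  then have "sum f (out_arcs G u) = sum f (in_arcs G u)"
    using sum_out_arcs_eq_sum_in_arcs[OF assms(1), of f] u
    by (simp add: sum.remove[OF finite_verts])
  with bal show ?thesis
    unfolding circulation_def by blast
qed

section \<open>Paths\<close>

lemma admissible_path_nth_customer:
  assumes "admissible_path N P" "s \<in> {1..<length P}"
  shows "P ! s \<in> customers N"
proof -
  have "tl P ! (s - 1) = P ! s"
    using assms(2) by (subst nth_tl) auto
  moreover have "tl P ! (s - 1) \<in> set (tl P)"
    using assms(2) by (intro nth_mem) auto
  ultimately show ?thesis
    using assms(1) by (auto simp: admissible_path_def)
qed

lemma admissible_path_nth_0:
  assumes "admissible_path N P"
  shows "P ! 0 = hd P" "hd P \<in> depots N"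
  using assms by (cases P; simp add: admissible_path_def)+

lemma admissible_path_distinct:
  assumes "irp_instance N" "admissible_path N P"
  shows "distinct P"
  using assms by (cases P) (auto simp: admissible_path_def irp_instance_def)

lemma admissible_path_loc_arcs:
  assumes N: "irp_instance N" and P: "admissible_path N P" and "i < j" "j < length P"
  shows "(P ! i, P ! j) \<in> loc_arcs N"
proof -
  have "P ! i \<noteq> P ! j"
    using admissible_path_distinct[OF N P] assms(3,4) by (simp add: nth_eq_iff_index_eq)
  moreover have "P ! j \<in> customers N"
    using admissible_path_nth_customer[OF P] assms(3,4) by simp
  moreover have "P ! i \<in> depots N \<union> customers N"
    using admissible_path_nth_customer[OF P, of i] admissible_path_nth_0[OF P] assms(3,4)
    by (cases "i = 0") auto
  ultimately show ?thesis
    by (auto simp: loc_arcs_def)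
qed

lemma sum_path_arcs:
  assumes "distinct P"
  shows "sum f (path_arcs P) = (\<Sum>i = 1..<length P. f (P ! (i - 1), P ! i))"
proof -
  have "inj_on (\<lambda>i. (P ! (i - 1), P ! i)) {1..<length P}"
    using assms by (auto simp: inj_on_def nth_eq_iff_index_eq)
  moreover have "path_arcs P = (\<lambda>i. (P ! (i - 1), P ! i)) ` {1..<length P}"
    by (auto simp: path_arcs_def)
  ultimately show ?thesis
    by (simp add: sum.reindex)
qed

lemma distance_le_partial_path:
  assumes N: "irp_instance N" and P: "admissible_path N P" and "s \<in> {1..<length P}"
  shows "distance N (P ! 0, P ! s) \<le> (\<Sum>i = 1..s. distance N (P ! (i - 1), P ! i))"
  using assms(3)
proof (induction s)
  case (Suc s)
  show ?case
  proof (cases "s = 0")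
    case False
    then have "distance N (P ! 0, P ! Suc s) \<le> distance N (P ! 0, P ! s) + distance N (P ! s, P ! Suc s)"
      using N Suc.prems admissible_path_loc_arcs[OF N P]
      unfolding irp_instance_def by simp
    then show ?thesis
      using Suc False by simp
  qed simp
qed simp

text \<open>
  By the triangle inequality, skipping the stops in between does not lengthen the trip; the arcs
  after the stop only add to the right-hand side.
\<close>

lemma distance_le_path:
  assumes N: "irp_instance N" and P: "admissible_path N P" and s: "s \<in> {1..<length P}"
  shows "distance N (hd P, P ! s) \<le> (\<Sum>a\<in>path_arcs P. distance N a)"
proof -
  have "distance N (P ! 0, P ! s) \<le> (\<Sum>i = 1..s. distance N (P ! (i - 1), P ! i))"
    by (rule distance_le_partial_path) fact+
  also have "\<dots> \<le> (\<Sum>i = 1..<length P. distance N (P ! (i - 1), P ! i))"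
  proof (rule sum_mono2)
    show "0 \<le> distance N (P ! (i - 1), P ! i)" if "i \<in> {1..<length P} - {1..s}" for i
      using admissible_path_loc_arcs[OF N P, of "i - 1" i] that N by (auto simp: irp_instance_def)
  qed (use s in auto)
  also have "\<dots> = (\<Sum>a\<in>path_arcs P. distance N a)"
    by (rule sum_path_arcs[OF admissible_path_distinct[OF N P], symmetric])
  finally show ?thesis
    using admissible_path_nth_0(1)[OF P] by simp
qed

text \<open>
  Delayed transport arcs come from paths that end at the customer in question, so a route that
  continues after a stop is cut off there.
\<close>

lemma admissible_path_take:
  assumes "admissible_path N P" "s \<in> {1..<length P}"
  shows "admissible_path N (take (Suc s) P)"
  using assms set_take_subset[of s "tl P"]
  by (auto simp: admissible_path_def tl_take)

lemma travel_time_take: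
  assumes "s < length P"
  shows "travel_time N (take (Suc s) P) s = travel_time N P s"
  unfolding travel_time_def using assms by (intro sum.cong) auto

text \<open>
  The unit transport cost is a share of a trip with a single stop, which costs no more than the whole
  route: the route has at least one stop and is at least as long.
\<close>

lemma transport_cost_le_route_cost:
  assumes N: "irp_instance N" and r: "r \<in> routes N" and s: "s \<in> stops r" and m: "m \<in> commodities N"
  shows "transport_cost N m (hd (rpath r)) (rpath r ! s)
    \<le> com_length N m / veh_length N * route_cost N r"
proof -
  have P: "admissible_path N (rpath r)"
    using r by (simp add: routes_def)
  have "stop_cost N * 1 \<le> stop_cost N * real (length (rpath r) - 1)"
    using N P by (intro mult_left_mono) (auto simp: irp_instance_def admissible_path_def)
  moreover have "km_cost N * distance N (hd (rpath r), rpath r ! s)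
      \<le> km_cost N * (\<Sum>a\<in>path_arcs (rpath r). distance N a)"
    using N distance_le_path[OF N P s] by (intro mult_left_mono) (auto simp: irp_instance_def)
  moreover have "0 \<le> com_length N m / veh_length N"
    using N m by (auto simp: irp_instance_def less_imp_le)
  ultimately show ?thesis
    unfolding transport_cost_def route_cost_def by (intro mult_left_mono) auto
qed

lemma route_cost_nonneg:
  assumes N: "irp_instance N" and r: "r \<in> routes N"
  shows "0 \<le> route_cost N r"
proof -
  have P: "admissible_path N (rpath r)"
    using r by (simp add: routes_def)
  have "0 \<le> distance N a" if "a \<in> path_arcs (rpath r)" for a
    using that admissible_path_loc_arcs[OF N P] N by (auto simp: path_arcs_def irp_instance_def)
  then show ?thesis
    using N by (auto simp: route_cost_def irp_instance_def intro!: add_nonneg_nonneg mult_nonneg_nonneg sum_nonneg)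
qed

lemma exc_cost_nonneg:
  assumes "irp_instance N" "m \<in> commodities N" "v \<in> depots N \<union> customers N"
  shows "0 \<le> exc_cost N m v"
  using assms unfolding irp_instance_def
  by (cases "m \<in> customer_coms N v") (auto simp: less_imp_le)

lemma short_cost_nonneg:
  assumes "irp_instance N" "m \<in> commodities N" "c \<in> customers N"
  shows "0 \<le> short_cost N m c"
  using assms by (simp add: irp_instance_def)

section \<open>Deliveries\<close>

text \<open>
  A delivery is a route with the index of one of its stops. Only those of positive amount count,
  because a route may stop without unloading \<open>m\<close> at customers that do not occur in the commodity
  graph of \<open>m\<close>.
\<close>

definition deliveries :: "('m, 'v) irp \<Rightarrow> ('m, 'v) irp_sol \<Rightarrow> 'm \<Rightarrow> (('m, 'v) route \<times> nat) set" where
  "deliveries N S m = {(r, s). r \<in> routes N \<and> s \<in> stops r \<and> 0 < vehicles S r * qty r m s}"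

fun delivered :: "('m, 'v) irp_sol \<Rightarrow> 'm \<Rightarrow> ('m, 'v) route \<times> nat \<Rightarrow> nat" where
  "delivered S m (r, s) = vehicles S r * qty r m s"

fun delivery_arc :: "('m, 'v) irp \<Rightarrow> ('m, 'v) route \<times> nat \<Rightarrow> 'v carc" where
  "delivery_arc N (r, s) = (if s = 1 then Direct (dep_day r) (hd (rpath r)) (rpath r ! s)
     else Delayed (dep_day r) (hd (rpath r)) (arrival_day N (dep_day r) (rpath r) s) (rpath r ! s))"

fun is_transport :: "'v carc \<Rightarrow> bool" where
  "is_transport (Direct t d c) = True"
| "is_transport (Delayed t d t' c) = True"
| "is_transport _ = False"

lemma is_transport_delivery_arc [simp]: "is_transport (delivery_arc N p)"
  by (cases p) simp

definition delivery_cost :: "('m, 'v) irp \<Rightarrow> 'm \<Rightarrow> ('m, 'v) route \<times> nat \<Rightarrow> real" where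
  "delivery_cost N m = (\<lambda>(r, s). transport_cost N m (hd (rpath r)) (rpath r ! s))"

lemma unit_cost_delivery_arc:
  "unit_cost N m (delivery_arc N p) = ereal (delivery_cost N m p)"
  by (cases p) (simp add: delivery_cost_def)

lemma carc_tail_delivery_arc:
  "carc_tail N (delivery_arc N (r, s)) = Morning (dep_day r) (hd (rpath r))"
  by simp

text \<open>
  At the first stop, the arrival day of the direct arc is that of the route, because both come from
  the same single arc of the locations graph.
\<close>

lemma carc_head_delivery_arc:
  assumes "r \<in> routes N" "s \<in> stops r"
  shows "carc_head N (delivery_arc N (r, s))
    = Evening (arrival_day N (dep_day r) (rpath r) s) (rpath r ! s)"
  using assms admissible_path_nth_0(1)[of N "rpath r"]
  by (auto simp: arrival_day_def travel_time_def routes_def)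

lemma deliveries_subset: "deliveries N S m \<subseteq> (SIGMA r:routes N. stops r)"
  by (auto simp: deliveries_def)

lemma finite_deliveries:
  assumes "irp_instance N"
  shows "finite (deliveries N S m)"
  by (rule finite_subset[OF deliveries_subset]) (use finite_routes[OF assms] in auto)

text \<open>
  This translates between sums over deliveries and the nested sums over routes and stops in which
  the routing problem is stated; the pairs of amount zero make no difference.
\<close>

lemma sum_deliveries:
  fixes f :: "('m, 'v) route \<times> nat \<Rightarrow> 'a::semiring_1"
  assumes "irp_instance N"
  shows "(\<Sum>p\<in>{p \<in> deliveries N S m. B p}. f p * of_nat (delivered S m p))
    = (\<Sum>r\<in>routes N. \<Sum>s\<in>{s \<in> stops r. B (r, s)}. f (r, s) * of_nat (vehicles S r * qty r m s))"
proof -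
  have fin: "finite (routes N)"
    using assms by (rule finite_routes)
  have "(\<Sum>r\<in>routes N. \<Sum>s\<in>{s \<in> stops r. B (r, s)}. f (r, s) * of_nat (vehicles S r * qty r m s))
    = (\<Sum>(r, s)\<in>(SIGMA r:routes N. {s \<in> stops r. B (r, s)}). f (r, s) * of_nat (vehicles S r * qty r m s))"
    using fin by (subst sum.Sigma) auto
  also have "\<dots> = (\<Sum>p\<in>{p \<in> deliveries N S m. B p}. f p * of_nat (delivered S m p))"
    by (rule sum.mono_neutral_cong_right) (use fin in \<open>auto simp: deliveries_def intro!: Nat.gr0I\<close>)
  finally show ?thesis by simp
qed

section \<open>The commodity graph\<close>

abbreviation com_locs :: "('m, 'v) irp \<Rightarrow> 'm \<Rightarrow> 'v set" where
  "com_locs N m \<equiv> com_depots N m \<union> com_customers N m"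

lemma commodity_graph_simps [simp]:
  "verts (commodity_graph N m) = com_verts N m"
  "arcs (commodity_graph N m) = com_arcs N m"
  "tail (commodity_graph N m) = carc_tail N"
  "head (commodity_graph N m) = carc_head N"
  by (simp_all add: commodity_graph_def)

lemma in_com_arcs_iff [simp]:
  "Initial v \<in> com_arcs N m \<longleftrightarrow> v \<in> com_locs N m"
  "Final v \<in> com_arcs N m \<longleftrightarrow> v \<in> com_locs N m"
  "Releasing t v \<in> com_arcs N m \<longleftrightarrow> t \<in> {1..horizon N} \<and> v \<in> com_depots N m"
  "Demanding t v \<in> com_arcs N m \<longleftrightarrow> t \<in> {1..horizon N} \<and> v \<in> com_customers N m"
  "Lacking t v \<in> com_arcs N m \<longleftrightarrow> t \<in> {1..horizon N} \<and> v \<in> com_customers N m"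
  "Daytime t v \<in> com_arcs N m \<longleftrightarrow> t \<in> {1..horizon N} \<and> v \<in> com_locs N m"
  "Free_Inv t v \<in> com_arcs N m \<longleftrightarrow> t \<in> {1..horizon N} \<and> v \<in> com_locs N m"
  "Excess_Inv t v \<in> com_arcs N m \<longleftrightarrow> t \<in> {1..horizon N} \<and> v \<in> com_locs N m"
  "Direct t v w \<in> com_arcs N m \<longleftrightarrow> t \<in> {1..horizon N} \<and> v \<in> com_depots N m \<and>
     w \<in> com_customers N m \<and> arrival_day N t [v, w] 1 \<le> horizon N"
  "Delayed t v t' w \<in> com_arcs N m \<longleftrightarrow> t \<in> {1..horizon N} \<and> v \<in> com_depots N m \<and>
     w \<in> com_customers N m \<and> t' \<le> horizon N \<and>
     (\<exists>P. admissible_path N P \<and> 3 \<le> length P \<and> hd P = v \<and> last P = w \<and>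
        t' = arrival_day N t P (length P - 1))"
  "Source_Release \<in> com_arcs N m" "Source_Initial \<in> com_arcs N m"
  "Source_Shortage \<in> com_arcs N m" "Demand_Sink \<in> com_arcs N m"
  "Final_Sink \<in> com_arcs N m" "Sink_Source \<in> com_arcs N m"
  unfolding com_arcs_def Let_def by auto

lemma in_out_in_arcs_iff:
  "a \<in> out_arcs (commodity_graph N m) v \<longleftrightarrow> a \<in> com_arcs N m \<and> carc_tail N a = v"
  "a \<in> in_arcs (commodity_graph N m) v \<longleftrightarrow> a \<in> com_arcs N m \<and> carc_head N a = v"
  by auto

lemma com_depot_not_customer:
  assumes "irp_instance N" "v \<in> com_depots N m"
  shows "v \<notin> com_customers N m" "v \<in> depots N"
  using assms by (auto simp: irp_instance_def com_depots_def com_customers_def)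

lemma com_customer_not_depot:
  assumes "irp_instance N" "v \<in> com_customers N m"
  shows "v \<notin> com_depots N m" "v \<notin> depots N" "v \<in> customers N"
  using assms by (auto simp: irp_instance_def com_depots_def com_customers_def)

lemma finite_com_locs:
  assumes "irp_instance N"
  shows "finite (com_depots N m)" "finite (com_customers N m)"
  using assms by (auto simp: irp_instance_def com_depots_def com_customers_def)

lemma finite_com_arcs:
  assumes "irp_instance N"
  shows "finite (com_arcs N m)"
  using fin_digraph.finite_arcs[OF fin_digraph_commodity_graph[OF assms, of m]] by simp

text \<open>
  The arcs at each vertex are listed explicitly, except for the transport arcs, whose total is
  computed from the deliveries below.
\<close>

lemma out_arcs_evening:
  assumes "t \<in> {1..horizon N}" "v \<in> com_locs N m"
  shows "out_arcs (commodity_graph N m) (Evening t v) = {Free_Inv t v, Excess_Inv t v}"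
  by (rule set_eqI, rename_tac a, case_tac a) (use assms in \<open>auto simp: in_out_in_arcs_iff\<close>)

lemma in_arcs_evening:
  assumes "t \<in> {1..horizon N}" "v \<in> com_locs N m"
  shows "in_arcs (commodity_graph N m) (Evening t v)
    = insert (Daytime t v) {a \<in> com_arcs N m. is_transport a \<and> carc_head N a = Evening t v}"
  by (rule set_eqI, rename_tac a, case_tac a) (use assms in \<open>auto simp: in_out_in_arcs_iff\<close>)

lemma in_arcs_morning:
  assumes "t \<in> {1..horizon N + 1}" "v \<in> com_locs N m"
  shows "in_arcs (commodity_graph N m) (Morning t v)
    = (if t = 1 then {Initial v} else {Free_Inv (t - 1) v, Excess_Inv (t - 1) v})
      \<union> (if t \<le> horizon N \<and> v \<in> com_depots N m then {Releasing t v} else {})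
      \<union> (if t \<le> horizon N \<and> v \<in> com_customers N m then {Lacking t v} else {})"
  by (rule set_eqI, rename_tac a, case_tac a) (use assms in \<open>auto simp: in_out_in_arcs_iff\<close>)

lemma out_arcs_morning_depot:
  assumes "irp_instance N" "t \<in> {1..horizon N}" "v \<in> com_depots N m"
  shows "out_arcs (commodity_graph N m) (Morning t v)
    = insert (Daytime t v) {a \<in> com_arcs N m. is_transport a \<and> carc_tail N a = Morning t v}"
  by (rule set_eqI, rename_tac a, case_tac a)
    (use assms com_depot_not_customer[OF assms(1,3)] in \<open>auto simp: in_out_in_arcs_iff\<close>)

lemma out_arcs_morning_customer:
  assumes "irp_instance N" "t \<in> {1..horizon N}" "v \<in> com_customers N m"
  shows "out_arcs (commodity_graph N m) (Morning t v) = {Daytime t v, Demanding t v}"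
  by (rule set_eqI, rename_tac a, case_tac a)
    (use assms com_customer_not_depot[OF assms(1,3)] in \<open>auto simp: in_out_in_arcs_iff\<close>)

lemma out_arcs_morning_last:
  assumes "v \<in> com_locs N m"
  shows "out_arcs (commodity_graph N m) (Morning (horizon N + 1) v) = {Final v}"
  by (rule set_eqI, rename_tac a, case_tac a) (use assms in \<open>auto simp: in_out_in_arcs_iff\<close>)

lemma out_arcs_artificial:
  "out_arcs (commodity_graph N m) Sink = {Sink_Source}"
  "out_arcs (commodity_graph N m) Demand = {Demand_Sink}"
  "out_arcs (commodity_graph N m) Final_Inventory = {Final_Sink}"
  "out_arcs (commodity_graph N m) Initial_Inventory = Initial ` com_locs N m"
  "out_arcs (commodity_graph N m) Release
     = (\<lambda>(t, v). Releasing t v) ` ({1..horizon N} \<times> com_depots N m)"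
  "out_arcs (commodity_graph N m) Shortage
     = (\<lambda>(t, v). Lacking t v) ` ({1..horizon N} \<times> com_customers N m)"
  by (rule set_eqI, rename_tac a, case_tac a; auto simp: in_out_in_arcs_iff)+

lemma in_arcs_artificial:
  "in_arcs (commodity_graph N m) Sink = {Demand_Sink, Final_Sink}"
  "in_arcs (commodity_graph N m) Demand
     = (\<lambda>(t, v). Demanding t v) ` ({1..horizon N} \<times> com_customers N m)"
  "in_arcs (commodity_graph N m) Final_Inventory = Final ` com_locs N m"
  "in_arcs (commodity_graph N m) Initial_Inventory = {Source_Initial}"
  "in_arcs (commodity_graph N m) Release = {Source_Release}"
  "in_arcs (commodity_graph N m) Shortage = {Source_Shortage}"
  by (rule set_eqI, rename_tac a, case_tac a; auto simp: in_out_in_arcs_iff)+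

section \<open>The flow induced by a solution\<close>

text \<open>
  Overnight inventory fills the free arc first. What passes through a day is all of the evening
  inventory at a depot, where nothing arrives in the evening, but only the stock left after the
  demand at a customer. The artificial arcs carry the totals that balance requires, and the last
  equation covers the two kinds of transport arcs.
\<close>

fun induced_flow :: "('m, 'v) irp \<Rightarrow> ('m, 'v) irp_sol \<Rightarrow> 'm \<Rightarrow> 'v carc \<Rightarrow> real" where
  "induced_flow N S m (Initial v) = real (init_inv N m v)"
| "induced_flow N S m (Final v) = real (inv_level S m v (horizon N))"
| "induced_flow N S m (Releasing t d) = real (release N m d t)"
| "induced_flow N S m (Demanding t c) = real (demand N m c t)"
| "induced_flow N S m (Lacking t c)
     = max (real (demand N m c t) - real (inv_level S m c (t - 1))) 0"
| "induced_flow N S m (Daytime t v) = (if v \<in> depots N then real (inv_level S m v t)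
     else max (real (inv_level S m v (t - 1)) - real (demand N m v t)) 0)"
| "induced_flow N S m (Free_Inv t v) = min (real (inv_level S m v t)) (free_cap N m v t)"
| "induced_flow N S m (Excess_Inv t v) = max (real (inv_level S m v t) - free_cap N m v t) 0"
| "induced_flow N S m Source_Initial = (\<Sum>v\<in>com_locs N m. real (init_inv N m v))"
| "induced_flow N S m Source_Release
     = (\<Sum>(t, d)\<in>{1..horizon N} \<times> com_depots N m. real (release N m d t))"
| "induced_flow N S m Source_Shortage = (\<Sum>(t, c)\<in>{1..horizon N} \<times> com_customers N m.
     max (real (demand N m c t) - real (inv_level S m c (t - 1))) 0)"
| "induced_flow N S m Demand_Sink
     = (\<Sum>(t, c)\<in>{1..horizon N} \<times> com_customers N m. real (demand N m c t))"
| "induced_flow N S m Final_Sink = (\<Sum>v\<in>com_locs N m. real (inv_level S m v (horizon N)))"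
| "induced_flow N S m Sink_Source
     = (\<Sum>(t, c)\<in>{1..horizon N} \<times> com_customers N m. real (demand N m c t))
       + (\<Sum>v\<in>com_locs N m. real (inv_level S m v (horizon N)))"
| "induced_flow N S m a = (\<Sum>p\<in>{p \<in> deliveries N S m. delivery_arc N p = a}. real (delivered S m p))"

lemma induced_flow_transport:
  "is_transport a \<Longrightarrow> induced_flow N S m a
     = (\<Sum>p\<in>{p \<in> deliveries N S m. delivery_arc N p = a}. real (delivered S m p))"
  by (cases a) auto

lemma induced_flow_overnight:
  "induced_flow N S m (Free_Inv t v) + induced_flow N S m (Excess_Inv t v) = real (inv_level S m v t)"
  by auto

text \<open>
  These are the solutions whose deliveries can all be represented in the commodity graphs. They
  include all solutions of finite cost.
\<close>

locale thrifty_solution =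
  fixes N :: "('m, 'v) irp" and S :: "('m, 'v) irp_sol"
  assumes N: "irp_instance N" and feasible: "irp_feasible N S"
    and thrifty: "\<And>m c t. c \<in> customers N \<Longrightarrow> m \<in> commodities N - customer_coms N c \<Longrightarrow>
      t \<in> {1..horizon N} \<Longrightarrow> received S m c t = 0"
begin

lemma inv_0:
  assumes "m \<in> commodities N" "v \<in> depots N \<union> customers N"
  shows "inv_level S m v 0 = init_inv N m v"
  using feasible assms by (auto simp: irp_feasible_def)

lemma inv_depot:
  assumes "m \<in> commodities N" "d \<in> depots N" "t \<in> {1..horizon N}"
  shows "inv_level S m d t + sent S m d t = inv_level S m d (t - 1) + release N m d t"
proof -
  have "int (inv_level S m d t)
      = int (inv_level S m d (t - 1)) + int (release N m d t) - int (sent S m d t)"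
    using feasible assms by (auto simp: irp_feasible_def)
  then show ?thesis by linarith
qed

lemma inv_customer:
  assumes "m \<in> commodities N" "c \<in> customers N" "t \<in> {1..horizon N}"
  shows "real (inv_level S m c t)
    = max (real (inv_level S m c (t - 1)) - real (demand N m c t)) 0 + real (received S m c t)"
proof -
  have "int (inv_level S m c t)
      = max (int (inv_level S m c (t - 1)) - int (demand N m c t)) 0 + int (received S m c t)"
    using feasible assms by (auto simp: irp_feasible_def)
  then show ?thesis by linarith
qed

text \<open>Departures and arrivals are thus the total flow on the transport arcs at the matching vertex.\<close>

lemma sent_eq:
  assumes "m \<in> commodities N" "d \<in> depots N" "t \<in> {1..horizon N}"
  shows "sent S m d t
    = (\<Sum>p\<in>{p \<in> deliveries N S m. carc_tail N (delivery_arc N p) = Morning t d}. delivered S m p)"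
proof -
  have "sent S m d t = (\<Sum>r\<in>{r \<in> routes N. hd (rpath r) = d \<and> dep_day r = t}.
      \<Sum>s\<in>stops r. vehicles S r * qty r m s)"
    using feasible assms by (auto simp: irp_feasible_def)
  also have "\<dots> = (\<Sum>r\<in>routes N.
      \<Sum>s\<in>{s \<in> stops r. carc_tail N (delivery_arc N (r, s)) = Morning t d}. vehicles S r * qty r m s)"
    unfolding carc_tail_delivery_arc
    by (rule sum.mono_neutral_cong_left) (use finite_routes[OF N] in \<open>auto intro!: sum.cong\<close>)
  finally show ?thesis
    using sum_deliveries[OF N, where S = S and m = m and f = "\<lambda>_. 1::nat"
        and B = "\<lambda>p. carc_tail N (delivery_arc N p) = Morning t d"] by simp
qed

lemma received_eq:
  assumes "m \<in> commodities N" "c \<in> customers N" "t \<in> {1..horizon N}"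
  shows "received S m c t
    = (\<Sum>p\<in>{p \<in> deliveries N S m. carc_head N (delivery_arc N p) = Evening t c}. delivered S m p)"
proof -
  have "received S m c t = (\<Sum>r\<in>routes N.
      \<Sum>s\<in>{s \<in> stops r. arrival_day N (dep_day r) (rpath r) s = t \<and> rpath r ! s = c}.
        vehicles S r * qty r m s)"
    using feasible assms by (auto simp: irp_feasible_def)
  also have "\<dots> = (\<Sum>r\<in>routes N.
      \<Sum>s\<in>{s \<in> stops r. carc_head N (delivery_arc N (r, s)) = Evening t c}. vehicles S r * qty r m s)"
    by (intro sum.cong) (auto simp: carc_head_delivery_arc simp del: delivery_arc.simps)
  finally show ?thesis
    using sum_deliveries[OF N, where S = S and m = m and f = "\<lambda>_. 1::nat"
        and B = "\<lambda>p. carc_head N (delivery_arc N p) = Evening t c"] by simp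
qed

text \<open>
  A depot outside the commodity graph has no initial inventory and no releases, hence never any
  stock, so sending a positive amount would make its inventory negative.
\<close>

lemma delivery_depot:
  assumes m: "m \<in> commodities N" and p: "(r, s) \<in> deliveries N S m"
  shows "hd (rpath r) \<in> com_depots N m"
proof (rule ccontr)
  let ?d = "hd (rpath r)" and ?t = "dep_day r"
  assume "?d \<notin> com_depots N m"
  moreover have d: "?d \<in> depots N" and t: "?t \<in> {1..horizon N}"
    using p admissible_path_nth_0[of N "rpath r"] by (auto simp: deliveries_def routes_def)
  ultimately have none: "init_inv N m ?d = 0" "\<And>t. t \<in> {1..horizon N} \<Longrightarrow> release N m ?d t = 0"
    using m by (auto simp: com_depots_def depot_coms_def)
  have empty: "inv_level S m ?d t = 0" if "t \<le> horizon N" for t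
    using that
  proof (induction t)
    case 0
    then show ?case using inv_0[OF m, of ?d] d none by simp
  next
    case (Suc t)
    then show ?case using inv_depot[OF m d, of "Suc t"] none by simp
  qed
  have "sent S m ?d ?t = 0"
  proof -
    have "?t - 1 \<le> horizon N"
      using t by auto
    from empty[OF this] show ?thesis
      using inv_depot[OF m d t] none(2)[OF t] by linarith
  qed
  then have "delivered S m (r, s) = 0"
    using p finite_deliveries[OF N, of S m] unfolding sent_eq[OF m d t] by auto
  with p show False
    by (auto simp: deliveries_def)
qed

text \<open>Otherwise the customer would receive a commodity that it does not use.\<close>

lemma delivery_customer:
  assumes m: "m \<in> commodities N" and p: "(r, s) \<in> deliveries N S m"
  shows "rpath r ! s \<in> com_customers N m"
proof (rule ccontr)
  let ?c = "rpath r ! s" and ?t = "arrival_day N (dep_day r) (rpath r) s"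
  assume "?c \<notin> com_customers N m"
  moreover have r: "r \<in> routes N" "s \<in> stops r"
    using p by (auto simp: deliveries_def)
  then have c: "?c \<in> customers N" and t: "?t \<in> {1..horizon N}"
    using admissible_path_nth_customer[of N "rpath r" s] by (auto simp: routes_def arrival_day_def)
  ultimately have "received S m ?c ?t = 0"
    using m by (intro thrifty) (auto simp: com_customers_def)
  moreover have "carc_head N (delivery_arc N (r, s)) = Evening ?t ?c"
    by (rule carc_head_delivery_arc) fact+
  ultimately have "delivered S m (r, s) = 0"
    using p finite_deliveries[OF N, of S m] unfolding received_eq[OF m c t] by auto
  with p show False
    by (auto simp: deliveries_def)
qed

lemma delivery_arc_in_com_arcs:
  assumes m: "m \<in> commodities N" and p: "p \<in> deliveries N S m"
  shows "delivery_arc N p \<in> com_arcs N m"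
proof -
  obtain r s where [simp]: "p = (r, s)" by (cases p)
  let ?P = "rpath r" and ?t = "dep_day r"
  have r: "r \<in> routes N" "s \<in> stops r"
    using p by (auto simp: deliveries_def)
  then have P: "admissible_path N ?P" and t: "?t \<in> {1..horizon N}"
    and arr: "arrival_day N ?t ?P s \<le> horizon N"
    by (auto simp: routes_def)
  have ends: "hd ?P \<in> com_depots N m" "?P ! s \<in> com_customers N m"
    using delivery_depot[OF m] delivery_customer[OF m] p by auto
  show ?thesis
  proof (cases "s = 1")
    case True
    then have "arrival_day N ?t [hd ?P, ?P ! s] 1 \<le> horizon N"
      using arr admissible_path_nth_0(1)[OF P] by (simp add: arrival_day_def travel_time_def)
    with True t ends show ?thesis by auto
  next
    case False
    let ?Q = "take (Suc s) ?P"
    have "length ?Q = Suc s" "last ?Q = ?P ! s"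
      using r(2) by (auto simp: take_Suc_conv_app_nth)
    moreover have "hd ?Q = hd ?P"
      by (simp add: hd_take)
    moreover have "arrival_day N ?t ?P s = arrival_day N ?t ?Q s"
      using r(2) by (simp add: arrival_day_def travel_time_take)
    ultimately have "\<exists>Q. admissible_path N Q \<and> 3 \<le> length Q \<and> hd Q = hd ?P \<and> last Q = ?P ! s \<and>
        arrival_day N ?t ?P s = arrival_day N ?t Q (length Q - 1)"
      using admissible_path_take[OF P r(2)] False r(2) by (intro exI[of _ ?Q]) auto
    with False t ends arr show ?thesis by auto
  qed
qed

text \<open>
  Grouping the deliveries by their arcs loses none of them, since all these arcs belong to the
  commodity graph. With weight one this gives the flow into or out of a vertex, with the unit costs
  the transport cost.
\<close>

lemma sum_transport:
  assumes m: "m \<in> commodities N"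
  shows "(\<Sum>a\<in>{a \<in> com_arcs N m. is_transport a \<and> B a}. g a * induced_flow N S m a)
    = (\<Sum>p\<in>{p \<in> deliveries N S m. B (delivery_arc N p)}. g (delivery_arc N p) * real (delivered S m p))"
proof -
  let ?A = "{a \<in> com_arcs N m. is_transport a \<and> B a}"
  let ?D = "{p \<in> deliveries N S m. B (delivery_arc N p)}"
  have "(\<Sum>a\<in>?A. g a * induced_flow N S m a)
    = (\<Sum>a\<in>?A. \<Sum>p\<in>{p \<in> ?D. delivery_arc N p = a}. g (delivery_arc N p) * real (delivered S m p))"
    by (rule sum.cong)
      (auto simp: induced_flow_transport sum_distrib_left intro!: sum.cong)
  also have "\<dots> = (\<Sum>p\<in>?D. g (delivery_arc N p) * real (delivered S m p))"
    by (rule sum.group)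
      (use finite_deliveries[OF N] finite_com_arcs[OF N] delivery_arc_in_com_arcs[OF m] in auto)
  finally show ?thesis .
qed

lemma transport_from_depot:
  assumes m: "m \<in> commodities N" and d: "d \<in> com_depots N m" and t: "t \<in> {1..horizon N}"
  shows "(\<Sum>a\<in>{a \<in> com_arcs N m. is_transport a \<and> carc_tail N a = Morning t d}. induced_flow N S m a)
    = real (sent S m d t)"
  using sum_transport[OF m, where B = "\<lambda>a. carc_tail N a = Morning t d" and g = "\<lambda>_. 1"]
    sent_eq[OF m com_depot_not_customer(2)[OF N d] t] by simp

lemma transport_to_customer:
  assumes m: "m \<in> commodities N" and c: "c \<in> com_customers N m" and t: "t \<in> {1..horizon N}"
  shows "(\<Sum>a\<in>{a \<in> com_arcs N m. is_transport a \<and> carc_head N a = Evening t c}. induced_flow N S m a)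
    = real (received S m c t)"
  using sum_transport[OF m, where B = "\<lambda>a. carc_head N a = Evening t c" and g = "\<lambda>_. 1"]
    received_eq[OF m com_customer_not_depot(3)[OF N c] t] by simp

lemma no_transport_to_depot:
  assumes "d \<in> com_depots N m"
  shows "{a \<in> com_arcs N m. is_transport a \<and> carc_head N a = Evening t d} = {}"
proof -
  have "\<not> (a \<in> com_arcs N m \<and> is_transport a \<and> carc_head N a = Evening t d)" for a
    using com_depot_not_customer[OF N assms] by (cases a) auto
  then show ?thesis by blast
qed

text \<open>
  At a depot nothing arrives in the evening; at a customer, the stock left after the demand and the
  deliveries make up the new inventory.
\<close>

lemma balance_evening:
  assumes m: "m \<in> commodities N" and t: "t \<in> {1..horizon N}" and v: "v \<in> com_locs N m"
  shows "sum (induced_flow N S m) (out_arcs (commodity_graph N m) (Evening t v))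
    = sum (induced_flow N S m) (in_arcs (commodity_graph N m) (Evening t v))"
proof -
  let ?In = "{a \<in> com_arcs N m. is_transport a \<and> carc_head N a = Evening t v}"
  have "sum (induced_flow N S m) (in_arcs (commodity_graph N m) (Evening t v))
      = induced_flow N S m (Daytime t v) + sum (induced_flow N S m) ?In"
    unfolding in_arcs_evening[OF t v] using finite_com_arcs[OF N, of m] by simp
  also have "\<dots> = real (inv_level S m v t)"
  proof (cases "v \<in> com_depots N m")
    case True
    show ?thesis
      unfolding no_transport_to_depot[OF True] using com_depot_not_customer[OF N True] by simp
  next
    case False
    then have c: "v \<in> com_customers N m"
      using v by simp
    show ?thesis
      unfolding transport_to_customer[OF m c t]
      using inv_customer[OF m _ t, of v] com_customer_not_depot[OF N c] by simp
  qed
  finally show ?thesis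
    unfolding out_arcs_evening[OF t v] by simp
qed

lemma carried_over:
  assumes m: "m \<in> commodities N" and t: "t \<in> {1..horizon N + 1}" and v: "v \<in> com_locs N m"
  shows "sum (induced_flow N S m) (if t = 1 then {Initial v} else {Free_Inv (t - 1) v, Excess_Inv (t - 1) v})
    = real (inv_level S m v (t - 1))"
  using inv_0[OF m, of v] com_depot_not_customer(2)[OF N, of v m] com_customer_not_depot(3)[OF N, of v m] v
  by auto

text \<open>
  At a depot this is the inventory recursion. At a customer the recursion does not enter: with stock
  \<open>x\<close> and demand \<open>b\<close>, it is the identity \<open>x + (b - x)\<^sup>+ = b + (x - b)\<^sup>+\<close>.
\<close>

lemma balance_morning:
  assumes m: "m \<in> commodities N" and t: "t \<in> {1..horizon N + 1}" and v: "v \<in> com_locs N m"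
  shows "sum (induced_flow N S m) (out_arcs (commodity_graph N m) (Morning t v))
    = sum (induced_flow N S m) (in_arcs (commodity_graph N m) (Morning t v))"
proof -
  let ?y = "induced_flow N S m"
  \<comment> \<open>The arcs that carry the initial stock or that of the previous night.\<close>
  define X where "X = (if t = 1 then {Initial v} else {Free_Inv (t - 1) v, Excess_Inv (t - 1) v})"
  have X: "finite X" "Releasing t v \<notin> X" "Lacking t v \<notin> X" "sum ?y X = real (inv_level S m v (t - 1))"
    using carried_over[OF m t v] by (auto simp: X_def)
  note ins = in_arcs_morning[OF t v, folded X_def]
  consider "t = horizon N + 1" | "t \<in> {1..horizon N}" "v \<in> com_depots N m"
    | "t \<in> {1..horizon N}" "v \<in> com_customers N m"
    using t v by fastforce
  then show ?thesis
  proof cases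
    case 1
    then show ?thesis
      using X v unfolding ins by (simp add: out_arcs_morning_last[simplified])
  next
    case 2
    note d = com_depot_not_customer[OF N 2(2)]
    have "sum ?y (out_arcs (commodity_graph N m) (Morning t v)) = real (inv_level S m v t) + real (sent S m v t)"
      unfolding out_arcs_morning_depot[OF N 2] transport_from_depot[OF m 2(2,1), symmetric]
      using finite_com_arcs[OF N, of m] d by simp
    moreover have "sum ?y (in_arcs (commodity_graph N m) (Morning t v))
        = real (inv_level S m v (t - 1)) + real (release N m v t)"
      unfolding ins using 2 X d by (simp add: add.commute)
    ultimately show ?thesis
      using inv_depot[OF m d(2) 2(1)] by linarith
  next
    case 3
    note c = com_customer_not_depot[OF N 3(2)]
    show ?thesis
      unfolding ins out_arcs_morning_customer[OF N 3] using 3 X c by auto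
  qed
qed

lemma circulation_induced_flow:
  assumes m: "m \<in> commodities N"
  shows "circulation (commodity_graph N m) (induced_flow N S m)"
proof (rule circulationI_except_one[OF fin_digraph_commodity_graph[OF N], of Source])
  fix v assume "v \<in> verts (commodity_graph N m)" and "v \<noteq> Source"
  then consider t u where "v = Morning t u" "t \<in> {1..horizon N + 1}" "u \<in> com_locs N m"
    | t u where "v = Evening t u" "t \<in> {1..horizon N}" "u \<in> com_locs N m"
    | "v \<in> {Sink, Initial_Inventory, Final_Inventory, Release, Shortage, Demand}"
    by (auto simp: com_verts_def)
  then show "sum (induced_flow N S m) (out_arcs (commodity_graph N m) v)
      = sum (induced_flow N S m) (in_arcs (commodity_graph N m) v)"
  proof cases
    case 1
    then show ?thesis using balance_morning[OF m] by simp
  next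
    case 2
    then show ?thesis using balance_evening[OF m] by simp
  next
    case 3
    have inj: "inj_on (\<lambda>p. Releasing (fst p) (snd p)) A" "inj_on (\<lambda>p. Demanding (fst p) (snd p)) A"
      "inj_on (\<lambda>p. Lacking (fst p) (snd p)) A" "inj_on Initial B" "inj_on Final B" for A B
      by (auto simp: inj_on_def)
    from 3 show ?thesis
      by (elim insertE emptyE)
        (simp_all add: out_arcs_artificial in_arcs_artificial sum.reindex[OF inj(1)]
          sum.reindex[OF inj(2)] sum.reindex[OF inj(3)] sum.reindex[OF inj(4)] sum.reindex[OF inj(5)]
          case_prod_unfold)
  qed
qed (simp add: com_verts_def)

lemma induced_flow_within_bounds:
  assumes m: "m \<in> commodities N" and a: "a \<in> com_arcs N m"
  shows "lower_bound N m a \<le> induced_flow N S m a \<and> ereal (induced_flow N S m a) \<le> upper_bound N m a"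
proof -
  have cap: "0 \<le> free_cap N m v t" if "v \<in> com_locs N m" "t \<in> {1..horizon N}" for v t
    using that N m com_depot_not_customer(2)[OF N, of v m] com_customer_not_depot(3)[OF N, of v m]
    unfolding irp_instance_def by blast
  show ?thesis
    using a by (cases a) (auto intro!: sum_nonneg add_nonneg_nonneg cap)
qed

lemma flow_feasible_induced_flow: "flow_feasible N (induced_flow N S)"
  unfolding flow_feasible_def
  using circulation_induced_flow induced_flow_within_bounds by simp

section \<open>The cost of the induced flow\<close>

text \<open>
  Each delivered unit is charged its share \<open>\<ell>\<^sub>m / L\<close> of the route cost, and summed over the
  commodities and stops of one route the shares are at most 1 because the load fits into the vehicle.
\<close>

lemma transport_cost_le_vehicle_cost:
  "(\<Sum>m\<in>commodities N. \<Sum>p\<in>deliveries N S m. delivery_cost N m p * real (delivered S m p))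
    \<le> (\<Sum>r\<in>routes N. real (vehicles S r) * route_cost N r)"
proof -
  have L: "0 < veh_length N"
    using N by (simp add: irp_instance_def)
  have "(\<Sum>m\<in>commodities N. \<Sum>p\<in>deliveries N S m. delivery_cost N m p * real (delivered S m p))
    = (\<Sum>m\<in>commodities N. \<Sum>r\<in>routes N. \<Sum>s\<in>stops r.
        delivery_cost N m (r, s) * real (vehicles S r * qty r m s))"
  proof -
    have "{s \<in> stops r. True} = stops r" for r :: "('m, 'v) route"
      by auto
    then show ?thesis
      using sum_deliveries[OF N, where B = "\<lambda>_. True" and S = S and ?'a = real] by simp
  qed
  also have "\<dots> \<le> (\<Sum>m\<in>commodities N. \<Sum>r\<in>routes N. \<Sum>s\<in>stops r.
      (com_length N m / veh_length N * route_cost N r) * real (vehicles S r * qty r m s))"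
    using transport_cost_le_route_cost[OF N]
    by (intro sum_mono mult_right_mono) (auto simp: delivery_cost_def)
  also have "\<dots> = (\<Sum>r\<in>routes N. \<Sum>m\<in>commodities N. \<Sum>s\<in>stops r.
      (com_length N m / veh_length N * route_cost N r) * real (vehicles S r * qty r m s))"
    by (rule sum.swap)
  also have "\<dots> = (\<Sum>r\<in>routes N. real (vehicles S r) * route_cost N r / veh_length N
      * (\<Sum>m\<in>commodities N. com_length N m * (\<Sum>s\<in>stops r. real (qty r m s))))"
    by (simp add: sum_distrib_left sum_distrib_right mult_ac)
  also have "\<dots> \<le> (\<Sum>r\<in>routes N. real (vehicles S r) * route_cost N r / veh_length N * veh_length N)"
    using route_cost_nonneg[OF N] L by (intro sum_mono mult_left_mono) (auto simp: routes_def)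
  also have "\<dots> = (\<Sum>r\<in>routes N. real (vehicles S r) * route_cost N r)"
    using L by simp
  finally show ?thesis .
qed

text \<open>
  Only transport, excess and shortage arcs have a cost. The excess part stays in the extended reals,
  so that it can be compared directly with the routing cost.
\<close>

lemma commodity_flow_cost:
  assumes m: "m \<in> commodities N"
  shows "(\<Sum>a\<in>com_arcs N m. unit_cost N m a * ereal (induced_flow N S m a))
    = ereal (\<Sum>p\<in>deliveries N S m. delivery_cost N m p * real (delivered S m p))
      + (\<Sum>(t, v)\<in>{1..horizon N} \<times> com_locs N m.
          exc_cost N m v * ereal (max (real (inv_level S m v t) - free_cap N m v t) 0))
      + (\<Sum>(t, c)\<in>{1..horizon N} \<times> com_customers N m.
          ereal (short_cost N m c * max (real (demand N m c t) - real (inv_level S m c (t - 1))) 0))"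
    (is "_ = ?transport + ?excess + ?shortage")
proof -
  let ?f = "\<lambda>a. unit_cost N m a * ereal (induced_flow N S m a)"
  let ?A = "{a \<in> com_arcs N m. is_transport a}"
  let ?E = "(\<lambda>(t, v). Excess_Inv t v) ` ({1..horizon N} \<times> com_locs N m)"
  let ?L = "(\<lambda>(t, v). Lacking t v) ` ({1..horizon N} \<times> com_customers N m)"
  have fin: "finite ?A" "finite ?E" "finite ?L"
    using finite_com_arcs[OF N, of m] finite_com_locs[OF N, of m] by auto
  have "sum ?f (com_arcs N m) = sum ?f (?A \<union> ?E \<union> ?L)"
  proof (rule sum.mono_neutral_right)
    show "\<forall>a\<in>com_arcs N m - (?A \<union> ?E \<union> ?L). ?f a = 0"
    proof
      fix a assume "a \<in> com_arcs N m - (?A \<union> ?E \<union> ?L)"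
      then show "?f a = 0" by (cases a) auto
    qed
  qed (use finite_com_arcs[OF N, of m] in auto)
  also have "\<dots> = sum ?f (?A \<union> ?E) + sum ?f ?L"
    by (rule sum.union_disjoint) (use fin in auto)
  also have "sum ?f (?A \<union> ?E) = sum ?f ?A + sum ?f ?E"
    by (rule sum.union_disjoint) (use fin in auto)
  also have "sum ?f ?A = ?transport"
  proof -
    have "?f a = ereal (real_of_ereal (unit_cost N m a) * induced_flow N S m a)" if "a \<in> ?A" for a
      using that by (cases a) auto
    then have "sum ?f ?A = ereal (\<Sum>a\<in>?A. real_of_ereal (unit_cost N m a) * induced_flow N S m a)"
      by simp
    also have "\<dots> = ereal (\<Sum>p\<in>deliveries N S m.
        real_of_ereal (unit_cost N m (delivery_arc N p)) * real (delivered S m p))"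
      using sum_transport[OF m, where B = "\<lambda>_. True"] by simp
    also have "\<dots> = ?transport"
      by (simp add: unit_cost_delivery_arc)
    finally show ?thesis .
  qed
  also have "sum ?f ?E = ?excess"
    by (subst sum.reindex) (auto simp: inj_on_def intro!: sum.cong)
  also have "sum ?f ?L = ?shortage"
    by (subst sum.reindex) (auto simp: inj_on_def simp del: sum_ereal ereal_max intro!: sum.cong)
  finally show ?thesis .
qed

lemma flow_cost_induced_flow_le: "flow_cost N (induced_flow N S) \<le> irp_cost N S"
proof -
  let ?M = "commodities N" and ?T = "{1..horizon N}"
  define e where "e m v t = exc_cost N m v * ereal (max (real (inv_level S m v t) - free_cap N m v t) 0)"
    for m v t
  define h where "h m c t
    = ereal (short_cost N m c * max (real (demand N m c t) - real (inv_level S m c (t - 1))) 0)" for m c t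
  define w where "w m = (\<Sum>p\<in>deliveries N S m. delivery_cost N m p * real (delivered S m p))" for m
  have e: "0 \<le> e m v t" if "m \<in> ?M" "v \<in> depots N \<union> customers N" for m v t
    unfolding e_def by (intro ereal_0_le_mult exc_cost_nonneg[OF N that]) (simp add: le_max_iff_disj)
  have h: "0 \<le> h m c t" if "m \<in> ?M" "c \<in> customers N" for m c t
    unfolding h_def using short_cost_nonneg[OF N that] by simp
  have fin: "finite (depots N)" "finite (customers N)"
    using N by (auto simp: irp_instance_def)
  have "flow_cost N (induced_flow N S) = (\<Sum>m\<in>?M. ereal (w m)
      + (\<Sum>(t, v)\<in>?T \<times> com_locs N m. e m v t) + (\<Sum>(t, c)\<in>?T \<times> com_customers N m. h m c t))"
    unfolding flow_cost_def e_def h_def w_def by (simp add: commodity_flow_cost)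
  \<comment> \<open>The routing cost also counts locations outside the commodity graph, with nonnegative terms.\<close>
  also have "\<dots> \<le> (\<Sum>m\<in>?M. ereal (w m)
      + (\<Sum>(t, v)\<in>?T \<times> (depots N \<union> customers N). e m v t) + (\<Sum>(t, c)\<in>?T \<times> customers N. h m c t))"
    using fin by (intro sum_mono add_mono sum_mono2 order_refl)
      (auto simp: com_depots_def com_customers_def intro!: e h)
  also have "\<dots> = (\<Sum>m\<in>?M. ereal (w m)
      + ((\<Sum>d\<in>depots N. \<Sum>t\<in>?T. e m d t) + (\<Sum>c\<in>customers N. \<Sum>t\<in>?T. e m c t))
      + (\<Sum>c\<in>customers N. \<Sum>t\<in>?T. h m c t))"
  proof -
    have swap: "(\<Sum>(t, v)\<in>?T \<times> V. f v t) = (\<Sum>v\<in>V. \<Sum>t\<in>?T. f v t)" for V and f :: "'v \<Rightarrow> nat \<Rightarrow> ereal"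
      by (subst sum.swap) (simp add: sum.cartesian_product)
    have "depots N \<inter> customers N = {}"
      using N by (simp add: irp_instance_def)
    then show ?thesis
      unfolding swap using fin by (simp add: sum.union_disjoint)
  qed
  also have "\<dots> = ereal (\<Sum>m\<in>?M. w m)
      + (\<Sum>d\<in>depots N. \<Sum>t\<in>?T. \<Sum>m\<in>?M. e m d t)
      + (\<Sum>c\<in>customers N. \<Sum>t\<in>?T. \<Sum>m\<in>?M. e m c t + h m c t)"
  proof -
    have swap: "(\<Sum>m\<in>?M. \<Sum>v\<in>V. \<Sum>t\<in>?T. f m v t) = (\<Sum>v\<in>V. \<Sum>t\<in>?T. \<Sum>m\<in>?M. f m v t)"
      for V and f :: "'m \<Rightarrow> 'v \<Rightarrow> nat \<Rightarrow> ereal"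
      by (subst sum.swap, intro sum.cong refl, rule sum.swap)
    show ?thesis
      by (simp only: sum.distrib swap sum_ereal add_ac)
  qed
  also have "\<dots> \<le> irp_cost N S"
    unfolding irp_cost_def e_def h_def w_def
    using transport_cost_le_vehicle_cost by (intro add_mono order_refl) auto
  finally show ?thesis .
qed

end

section \<open>Solutions of infinite cost\<close>

text \<open>
  A delivery to a customer that does not use the commodity leaves a positive inventory there on that
  day, all of which is excess inventory of infinite unit cost.
\<close>

lemma thrifty_if_finite_cost:
  assumes N: "irp_instance N" and S: "irp_feasible N S" and fin: "irp_cost N S \<noteq> \<infinity>"
  shows "thrifty_solution N S"
proof
  fix m c t
  assume c: "c \<in> customers N" and m: "m \<in> commodities N - customer_coms N c"
    and t: "t \<in> {1..horizon N}"
  have fins: "finite (customers N)" "finite (commodities N)"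
    using N by (auto simp: irp_instance_def)
  let ?e = "exc_cost N m c * ereal (max (real (inv_level S m c t) - free_cap N m c t) 0)"
  have "?e \<noteq> \<infinity>"
    using fin c m t fins unfolding irp_cost_def by (auto simp: sum_Pinfty)
  moreover have "exc_cost N m c = \<infinity>" "free_cap N m c t = 0"
    using N c m t by (auto simp: irp_instance_def)
  ultimately have "inv_level S m c t = 0"
    by (auto split: if_splits)
  moreover have "int (inv_level S m c t)
      = max (int (inv_level S m c (t - 1)) - int (demand N m c t)) 0 + int (received S m c t)"
    using S c m t by (auto simp: irp_feasible_def)
  ultimately show "received S m c t = 0"
    by linarith
qed fact+

text \<open>
  With no vehicle on the road, stock piles up at the depots and customers use up what they have; the
  truncated subtraction in the last line is intended.
\<close>

fun idle_level :: "('m, 'v) irp \<Rightarrow> 'm \<Rightarrow> 'v \<Rightarrow> nat \<Rightarrow> nat" where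
  "idle_level N m v 0 = init_inv N m v"
| "idle_level N m v (Suc t) = (if v \<in> depots N then idle_level N m v t + release N m v (Suc t)
     else idle_level N m v t - demand N m v (Suc t))"

definition idle_solution :: "('m, 'v) irp \<Rightarrow> ('m, 'v) irp_sol" where
  "idle_solution N = \<lparr>vehicles = \<lambda>_. 0, sent = \<lambda>_ _ _. 0, received = \<lambda>_ _ _. 0,
     inv_level = idle_level N\<rparr>"

lemma thrifty_idle_solution:
  assumes N: "irp_instance N"
  shows "thrifty_solution N (idle_solution N)"
proof
  have "idle_level N m v t = (if v \<in> depots N then idle_level N m v (t - 1) + release N m v t
     else idle_level N m v (t - 1) - demand N m v t)" if "1 \<le> t" for m v t
    using that by (cases t) auto
  moreover have "v \<notin> depots N" if "v \<in> customers N" for v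
    using N that by (auto simp: irp_instance_def)
  ultimately show "irp_feasible N (idle_solution N)"
    by (auto simp: irp_feasible_def idle_solution_def)
qed (auto simp: idle_solution_def N)

theorem proposition4p1:
  fixes N :: "('m, 'v) irp"
  assumes "irp_instance N"
  shows "(\<forall>S. irp_feasible N S \<longrightarrow> (\<exists>y. flow_feasible N y \<and> flow_cost N y \<le> irp_cost N S))
    \<and> (\<forall>S. irp_optimal N S \<longrightarrow> flow_value N \<le> irp_cost N S)
    \<and> flow_value N \<le> irp_value N"
proof -
  have relax: "\<exists>y. flow_feasible N y \<and> flow_cost N y \<le> irp_cost N S" if "irp_feasible N S" for S
  proof (cases "irp_cost N S = \<infinity>")
    case True
    interpret thrifty_solution N "idle_solution N"
      using assms by (rule thrifty_idle_solution)
    show ?thesis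
      using flow_feasible_induced_flow True by auto
  next
    case False
    interpret thrifty_solution N S
      using assms that False by (rule thrifty_if_finite_cost)
    show ?thesis
      using flow_feasible_induced_flow flow_cost_induced_flow_le by blast
  qed
  then have lower: "flow_value N \<le> irp_cost N S" if "irp_feasible N S" for S
    using that unfolding flow_value_def by (auto intro: INF_lower2)
  then have "flow_value N \<le> irp_value N"
    unfolding irp_value_def by (auto intro: INF_greatest)
  with relax lower show ?thesis
    by (auto simp: irp_optimal_def)
qed

end
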